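(* Let $t$ be a PPC_dB term (well-formed, so that $\mathcal U(t)$ is defined). If $t\to_{dB}t'$, then $\mathcal U(t)\to_{PPC}\mathcal U(t')$.
   Context: **PPC.** Fix a countably infinite set of symbols. Terms: $t::=x\mid\hat x\mid t\,t\mid\lambda_\theta p.s$, where $\theta$ is a list of symbols binding the matchables $\hat x$ ($x\in\theta$) in $p$ and the variables $x$ in $s$. Terms are taken modulo $\alpha$-conversion. Substitutions are finite partial maps from symbols to terms, acting capture-avoidingly on variable occurrences. A match is a substitution, $\mathtt{fail}$ or $\mathtt{wait}$ (decided if not $\mathtt{wait}$). Data structures are $d::=\hat x\mid d\,t$; matchable forms are $m::=d\mid\lambda_\theta t.t$. $\mu\uplus\mu'$ is $\mathtt{fail}$ if either match is $\mathtt{fail}$; else $\mathtt{wait}$ if either is $\mathtt{wait}$; else $\mathtt{fail}$ if the domains intersect; else the union. Matching $\{p/u\}_\theta$ (first applicable clause): 1. $\{\hat x/u\}_\theta=\{x\mapsto u\}$ if $x\in\theta$; 2. $\{\hat x/\hat x\}_\theta=\{\}$ if $x\notin\theta$; 3. $\{p\,q/t\,u\}_\theta=\{p/t\}_\theta\uplus\{q/u\}_\theta$ if both are matchable forms; 4. $\mathtt{fail}$ if $p,u$ are matchable forms; 5. $\mathtt{wait}$ otherwise. A substitution result whose domain is not exactly $\theta$ becomes $\mathtt{fail}$. $\mathtt{fail}$ applied to any term gives $\lambda_{[x]}\hat x.x$. $\to_{PPC}$ is the contextual closure of $(\lambda_\theta p.s)u\to\{p/u\}_\theta s$ when the match is decided.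 **PPC_dB.** Terms: $t::=\mathsf v_{i,j}\mid\mathsf m_{i,j}\mid t\,t\mid\lambda_np.s$, with $i,j\ge1$ and $n\in\mathbb N$. For a set $S$ of pairs, $S-1$ subtracts $1$ from each primary index and drops the non-positive ones. Free indices: $fv(\mathsf v_{i,j})=\{(i,j)\}$, $fm(\mathsf m_{i,j})=\{(i,j)\}$ (empty otherwise); both are unions on applications; $fv(\lambda_np.s)=fv(p)\cup(fv(s)-1)$ and $fm(\lambda_np.s)=(fm(p)-1)\cup fm(s)$. Well-formed: every free index has secondary index $1$, and in each subterm $\lambda_np.s$ every pair $(1,j)\in fm(p)\cup fv(s)$ has $j\le n$. Increments and decrement: - $\uparrow^{\mathsf v}_k\mathsf v_{i,j}=\mathsf v_{i+1,j}$ if $i>k$, else unchanged; matchables unchanged; homomorphic on applications; $\uparrow^{\mathsf v}_k(\lambda_np.s)=\lambda_n\uparrow^{\mathsf v}_kp.\uparrow^{\mathsf v}_{k+1}s$; - $\uparrow^{\mathsf m}_k$ is symmetric, with $\uparrow^{\mathsf m}_k(\lambda_np.s)=\lambda_n\uparrow^{\mathsf m}_{k+1}p.\uparrow^{\mathsf m}_ks$; - $\downarrow^{\mathsf v}_k$ is like $\uparrow^{\mathsf v}_k$ but subtracts $1$; - the default depth is $0$. Substitution at level $i$, $\{\mathsf v_{i,j}\mapsto u_j\}_{j\in J}$: - maps $\mathsf v_{i,k}$ to $u_k$ ($k\in J$), leaves $\mathsf v_{i',k}$ with $i'\ne i$ and matchables unchanged; - is homomorphic on applications; - maps $\lambda_np.s$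 to $\lambda_n(\{\mathsf v_{i,j}\mapsto\uparrow^{\mathsf m}u_j\}p).(\{\mathsf v_{i+1,j}\mapsto\uparrow^{\mathsf v}u_j\}s)$. Data structures are $d::=\mathsf m_{i,j}\mid d\,t$; matchable forms are $m::=d\mid\lambda_nt.t$. Matching $\{p/u\}_n$: $\{\mathsf m_{1,j}/u\}_n=\{\mathsf v_{1,j}\mapsto u\}$; $\{\mathsf m_{i+1,j}/\mathsf m_{i,j}\}_n=\{\}$; then the application, $\mathtt{fail}$ and $\mathtt{wait}$ clauses as in PPC. A result whose domain is not $\{\mathsf v_{1,1},\dots,\mathsf v_{1,n}\}$ becomes $\mathtt{fail}$. $\mathtt{fail}$ applied to any term gives $\lambda_1\mathsf m_{1,1}.\mathsf v_{1,1}$. $\to_{dB}$ is the contextual closure of $(\lambda_np.s)u\to\downarrow^{\mathsf v}(\{p/\uparrow^{\mathsf v}u\}_ns)$ when the match is decided. **Backward translation.** For $V,M$ lists of lists of distinct symbols ($V_{ij}$ is the $j$-th element of the $i$-th list; $\theta++V$ means $[\theta]++V$): - $\mathcal U_{V,M}(\mathsf v_{i,j})=V_{ij}$ and $\mathcal U_{V,M}(\mathsf m_{i,j})=\widehat{M_{ij}}$; - homomorphic on applications; - $\mathcal U_{V,M}(\lambda_np.s)=\lambda_\theta\mathcal U_{V,\theta++M}(p).\mathcal U_{\theta++V,M}(s)$, with $\theta$ a list of $n$ fresh symbols. Fixing an enumeration $x_1,x_2,\dots$ of the symbols, $\mathcal U(t)=\mathcal U_{X,X}(t)$ with $X=[[x_1],\dots,[x_n]]$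 and $fv(t)\cup fm(t)\subseteq\{(1,1),\dots,(n,1)\}$. *)

theory Defs
  imports Main "HOL-Library.Finite_Map"
begin

section \<open>Matches\<close>

text \<open>Matches of both calculi: \<open>'k\<close> is the type of the keys of substitutions, \<open>'t\<close> that of terms.\<close>

datatype ('k, 't) mtch = Subst "('k, 't) fmap" | Fail | Wait

definition decided :: "('k, 't) mtch \<Rightarrow> bool" where
  "decided \<mu> \<longleftrightarrow> \<mu> \<noteq> Wait"

fun join :: "('k, 't) mtch \<Rightarrow> ('k, 't) mtch \<Rightarrow> ('k, 't) mtch" where
  "join Fail \<mu> = Fail"
| "join \<mu> Fail = Fail"
| "join Wait \<mu> = Wait"
| "join \<mu> Wait = Wait"
| "join (Subst \<sigma>) (Subst \<tau>) =
     (if fmdom' \<sigma> \<inter> fmdom' \<tau> \<noteq> {} then Fail else Subst (\<sigma> ++\<^sub>f \<tau>))"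

fun check_dom :: "'k set \<Rightarrow> ('k, 't) mtch \<Rightarrow> ('k, 't) mtch" where
  "check_dom D (Subst \<sigma>) = (if fmdom' \<sigma> = D then Subst \<sigma> else Fail)"
| "check_dom D \<mu> = \<mu>"


section \<open>PPC\<close>

subsection \<open>Preterms and alpha-conversion\<close>

text \<open>\<open>syms t\<close> is the set of all symbols written in \<open>t\<close>: free, bound, or listed at a binder.\<close>

datatype (syms: 'a) preterm =
    Var 'a
  | Mat 'a
  | App "'a preterm" "'a preterm"
  | Lam "'a list" "'a preterm" "'a preterm"

text \<open>
  \<open>ren_v f\<close> renames the free variables and \<open>ren_m f\<close> the free matchables. A binder \<open>\<theta>\<close> shields the
  variables of its body and the matchables of its pattern. Neither function avoids capture; they
  are only used with new symbols that do not occur in the term.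
\<close>

primrec ren_v :: "('a \<Rightarrow> 'a) \<Rightarrow> 'a preterm \<Rightarrow> 'a preterm" where
  "ren_v f (Var x) = Var (f x)"
| "ren_v f (Mat x) = Mat x"
| "ren_v f (App t u) = App (ren_v f t) (ren_v f u)"
| "ren_v f (Lam \<theta> p s) = Lam \<theta> (ren_v f p) (ren_v (override_on f id (set \<theta>)) s)"

primrec ren_m :: "('a \<Rightarrow> 'a) \<Rightarrow> 'a preterm \<Rightarrow> 'a preterm" where
  "ren_m f (Var x) = Var x"
| "ren_m f (Mat x) = Mat (f x)"
| "ren_m f (App t u) = App (ren_m f t) (ren_m f u)"
| "ren_m f (Lam \<theta> p s) = Lam \<theta> (ren_m (override_on f id (set \<theta>)) p) (ren_m f s)"

text \<open>\<open>rebind f\<close> changes the symbols \<open>\<theta>\<close> of the binder \<open>Lam \<theta> p s\<close> to \<open>map f \<theta>\<close>.\<close>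

definition rebind :: "('a \<Rightarrow> 'a) \<Rightarrow> 'a list \<Rightarrow> 'a preterm \<Rightarrow> 'a preterm \<Rightarrow> 'a preterm" where
  "rebind f \<theta> p s =
     Lam (map f \<theta>) (ren_m (override_on id f (set \<theta>)) p) (ren_v (override_on id f (set \<theta>)) s)"

definition fresh_ren :: "('a \<Rightarrow> 'a) \<Rightarrow> 'a list \<Rightarrow> 'a set \<Rightarrow> bool" where
  "fresh_ren f \<theta> A \<longleftrightarrow> inj_on f (set \<theta>) \<and> f ` set \<theta> \<inter> A = {}"

inductive alpha :: "'a preterm \<Rightarrow> 'a preterm \<Rightarrow> bool" where
  alpha_conv: "fresh_ren f \<theta> (syms p \<union> syms s) \<Longrightarrow> alpha (Lam \<theta> p s) (rebind f \<theta> p s)"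
| alpha_App: "alpha t t' \<Longrightarrow> alpha u u' \<Longrightarrow> alpha (App t u) (App t' u')"
| alpha_Lam: "alpha p p' \<Longrightarrow> alpha s s' \<Longrightarrow> alpha (Lam \<theta> p s) (Lam \<theta> p' s')"
| alpha_refl: "alpha t t"
| alpha_sym: "alpha t u \<Longrightarrow> alpha u t"
| alpha_trans: "alpha t u \<Longrightarrow> alpha u v \<Longrightarrow> alpha t v"

quotient_type 'a ppc = "'a preterm" / alpha
  by (intro equivpI reflpI sympI transpI) (auto intro: alpha_refl alpha_sym alpha_trans)

lift_definition PVar :: "'a \<Rightarrow> 'a ppc" is Var .

lift_definition PMat :: "'a \<Rightarrow> 'a ppc" is Mat .

lift_definition PApp :: "'a ppc \<Rightarrow> 'a ppc \<Rightarrow> 'a ppc" is App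
  by (rule alpha_App)

lift_definition PLam :: "'a list \<Rightarrow> 'a ppc \<Rightarrow> 'a ppc \<Rightarrow> 'a ppc" is Lam
  by (rule alpha_Lam)


subsection \<open>Substitution and matching on representatives\<close>

lemma size_ren_v [simp]: "size (ren_v f t) = size t"
  by (induction t arbitrary: f) auto

lemma size_ren_m [simp]: "size (ren_m f t) = size t"
  by (induction t arbitrary: f) auto

text \<open>
  To avoid capture, every binder met on the way is first changed to new symbols, which occur
  neither in the term nor in the substitution. Patterns need this as well: an inserted term may
  contain matchables that a binder \<open>\<theta>\<close> would capture.
\<close>

function psubst :: "('a, 'a preterm) fmap \<Rightarrow> 'a preterm \<Rightarrow> 'a preterm" where
  "psubst \<sigma> (Var x) = (case fmlookup \<sigma> x of Some u \<Rightarrow> u | None \<Rightarrow> Var x)"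
| "psubst \<sigma> (Mat x) = Mat x"
| "psubst \<sigma> (App t u) = App (psubst \<sigma> t) (psubst \<sigma> u)"
| "psubst \<sigma> (Lam \<theta> p s) =
     (let f = (SOME f. fresh_ren f \<theta>
                 (syms p \<union> syms s \<union> fmdom' \<sigma> \<union> (\<Union>u \<in> fmran' \<sigma>. syms u)));
          g = override_on id f (set \<theta>)
      in Lam (map f \<theta>) (psubst \<sigma> (ren_m g p)) (psubst \<sigma> (ren_v g s)))"
  by pat_completeness auto
termination by (relation "measure (\<lambda>(\<sigma>, t). size t)") auto

primrec data :: "'a preterm \<Rightarrow> bool" where
  "data (Var x) \<longleftrightarrow> False"
| "data (Mat x) \<longleftrightarrow> True"
| "data (App t u) \<longleftrightarrow> data t"
| "data (Lam \<theta> p s) \<longleftrightarrow> False"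

definition mform :: "'a preterm \<Rightarrow> bool" where
  "mform t \<longleftrightarrow> data t \<or> (\<exists>\<theta> p s. t = Lam \<theta> p s)"

fun pre_match :: "'a list \<Rightarrow> 'a preterm \<Rightarrow> 'a preterm \<Rightarrow> ('a, 'a preterm) mtch" where
  "pre_match \<theta> (Mat x) u =
     (if x \<in> set \<theta> then Subst (fmupd x u fmempty)
      else if u = Mat x then Subst fmempty
      else if mform u then Fail else Wait)"
| "pre_match \<theta> (App p q) (App t u) =
     (if mform (App p q) \<and> mform (App t u)
      then join (pre_match \<theta> p t) (pre_match \<theta> q u) else Wait)"
| "pre_match \<theta> p u = (if mform p \<and> mform u then Fail else Wait)"

definition pmatch :: "'a list \<Rightarrow> 'a preterm \<Rightarrow> 'a preterm \<Rightarrow> ('a, 'a preterm) mtch" where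
  "pmatch \<theta> p u = check_dom (set \<theta>) (pre_match \<theta> p u)"

text \<open>The symbol chosen for \<open>Fail\<close> is immaterial up to \<open>alpha\<close>; \<open>Wait\<close> is never applied.\<close>

fun papply :: "('a, 'a preterm) mtch \<Rightarrow> 'a preterm \<Rightarrow> 'a preterm" where
  "papply (Subst \<sigma>) s = psubst \<sigma> s"
| "papply Fail s = (let x = undefined in Lam [x] (Mat x) (Var x))"


subsection \<open>Reduction modulo alpha\<close>

text \<open>In the first rule \<open>\<theta>\<close>, \<open>p\<close>, \<open>s\<close>, \<open>u\<close> range over all representatives of the redex.\<close>

inductive ppc_step :: "'a ppc \<Rightarrow> 'a ppc \<Rightarrow> bool" where
  "decided (pmatch \<theta> p u) \<Longrightarrow>
     ppc_step (abs_ppc (App (Lam \<theta> p s) u)) (abs_ppc (papply (pmatch \<theta> p u) s))"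
| "ppc_step t t' \<Longrightarrow> ppc_step (PApp t u) (PApp t' u)"
| "ppc_step u u' \<Longrightarrow> ppc_step (PApp t u) (PApp t u')"
| "ppc_step p p' \<Longrightarrow> ppc_step (PLam \<theta> p s) (PLam \<theta> p' s)"
| "ppc_step s s' \<Longrightarrow> ppc_step (PLam \<theta> p s) (PLam \<theta> p s')"


section \<open>PPC with de Bruijn indices\<close>

text \<open>
  Indices are of type \<open>nat\<close>; the requirement that they start from 1 is \<open>pos_indices\<close> below,
  a part of \<open>well_formed\<close>.
\<close>

datatype db =
    DVar nat nat
  | DMat nat nat
  | DApp db db
  | DLam nat db db

definition lower :: "(nat \<times> nat) set \<Rightarrow> (nat \<times> nat) set" where
  "lower S = {(i - 1, j) | i j. (i, j) \<in> S \<and> i - 1 > 0}"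

primrec fv :: "db \<Rightarrow> (nat \<times> nat) set" where
  "fv (DVar i j) = {(i, j)}"
| "fv (DMat i j) = {}"
| "fv (DApp t u) = fv t \<union> fv u"
| "fv (DLam n p s) = fv p \<union> lower (fv s)"

primrec fm :: "db \<Rightarrow> (nat \<times> nat) set" where
  "fm (DVar i j) = {}"
| "fm (DMat i j) = {(i, j)}"
| "fm (DApp t u) = fm t \<union> fm u"
| "fm (DLam n p s) = lower (fm p) \<union> fm s"

primrec pos_indices :: "db \<Rightarrow> bool" where
  "pos_indices (DVar i j) \<longleftrightarrow> i \<ge> 1 \<and> j \<ge> 1"
| "pos_indices (DMat i j) \<longleftrightarrow> i \<ge> 1 \<and> j \<ge> 1"
| "pos_indices (DApp t u) \<longleftrightarrow> pos_indices t \<and> pos_indices u"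
| "pos_indices (DLam n p s) \<longleftrightarrow> pos_indices p \<and> pos_indices s"

primrec bounded :: "db \<Rightarrow> bool" where
  "bounded (DVar i j) \<longleftrightarrow> True"
| "bounded (DMat i j) \<longleftrightarrow> True"
| "bounded (DApp t u) \<longleftrightarrow> bounded t \<and> bounded u"
| "bounded (DLam n p s) \<longleftrightarrow>
     (\<forall>j. (1, j) \<in> fm p \<union> fv s \<longrightarrow> j \<le> n) \<and> bounded p \<and> bounded s"

definition well_formed :: "db \<Rightarrow> bool" where
  "well_formed t \<longleftrightarrow> pos_indices t \<and> (\<forall>(i, j) \<in> fv t \<union> fm t. j = 1) \<and> bounded t"

primrec inc_v :: "nat \<Rightarrow> db \<Rightarrow> db" where
  "inc_v k (DVar i j) = (if i > k then DVar (i + 1) j else DVar i j)"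
| "inc_v k (DMat i j) = DMat i j"
| "inc_v k (DApp t u) = DApp (inc_v k t) (inc_v k u)"
| "inc_v k (DLam n p s) = DLam n (inc_v k p) (inc_v (k + 1) s)"

primrec inc_m :: "nat \<Rightarrow> db \<Rightarrow> db" where
  "inc_m k (DVar i j) = DVar i j"
| "inc_m k (DMat i j) = (if i > k then DMat (i + 1) j else DMat i j)"
| "inc_m k (DApp t u) = DApp (inc_m k t) (inc_m k u)"
| "inc_m k (DLam n p s) = DLam n (inc_m (k + 1) p) (inc_m k s)"

primrec dec_v :: "nat \<Rightarrow> db \<Rightarrow> db" where
  "dec_v k (DVar i j) = (if i > k then DVar (i - 1) j else DVar i j)"
| "dec_v k (DMat i j) = DMat i j"
| "dec_v k (DApp t u) = DApp (dec_v k t) (dec_v k u)"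
| "dec_v k (DLam n p s) = DLam n (dec_v k p) (dec_v (k + 1) s)"

text \<open>The level \<open>i\<close> is kept apart from the map: the key \<open>j\<close> of \<open>\<sigma>\<close> stands for \<open>DVar i j\<close>.\<close>

primrec dsubst :: "nat \<Rightarrow> (nat, db) fmap \<Rightarrow> db \<Rightarrow> db" where
  "dsubst i \<sigma> (DVar i' k) =
     (if i' = i then (case fmlookup \<sigma> k of Some u \<Rightarrow> u | None \<Rightarrow> DVar i' k) else DVar i' k)"
| "dsubst i \<sigma> (DMat i' k) = DMat i' k"
| "dsubst i \<sigma> (DApp t u) = DApp (dsubst i \<sigma> t) (dsubst i \<sigma> u)"
| "dsubst i \<sigma> (DLam n p s) =
     DLam n (dsubst i (fmmap (inc_m 0) \<sigma>) p) (dsubst (i + 1) (fmmap (inc_v 0) \<sigma>) s)"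

primrec ddata :: "db \<Rightarrow> bool" where
  "ddata (DVar i j) \<longleftrightarrow> False"
| "ddata (DMat i j) \<longleftrightarrow> True"
| "ddata (DApp t u) \<longleftrightarrow> ddata t"
| "ddata (DLam n p s) \<longleftrightarrow> False"

definition dmform :: "db \<Rightarrow> bool" where
  "dmform t \<longleftrightarrow> ddata t \<or> (\<exists>n p s. t = DLam n p s)"

text \<open>The resulting substitutions are at level 1. The pattern lies under one more matchable binder
  than the argument, which explains the shift of the primary index.\<close>

fun pre_dmatch :: "db \<Rightarrow> db \<Rightarrow> (nat, db) mtch" where
  "pre_dmatch (DMat i j) u =
     (if i = 1 then Subst (fmupd j u fmempty)
      else if u = DMat (i - 1) j then Subst fmempty
      else if dmform u then Fail else Wait)"
| "pre_dmatch (DApp p q) (DApp t u) =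
     (if dmform (DApp p q) \<and> dmform (DApp t u)
      then join (pre_dmatch p t) (pre_dmatch q u) else Wait)"
| "pre_dmatch p u = (if dmform p \<and> dmform u then Fail else Wait)"

definition dmatch :: "nat \<Rightarrow> db \<Rightarrow> db \<Rightarrow> (nat, db) mtch" where
  "dmatch n p u = check_dom {1..n} (pre_dmatch p u)"

fun dapply :: "(nat, db) mtch \<Rightarrow> db \<Rightarrow> db" where
  "dapply (Subst \<sigma>) s = dsubst 1 \<sigma> s"
| "dapply Fail s = DLam 1 (DMat 1 1) (DVar 1 1)"

inductive db_step :: "db \<Rightarrow> db \<Rightarrow> bool" where
  "decided (dmatch n p (inc_v 0 u)) \<Longrightarrow>
     db_step (DApp (DLam n p s) u) (dec_v 0 (dapply (dmatch n p (inc_v 0 u)) s))"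
| "db_step t t' \<Longrightarrow> db_step (DApp t u) (DApp t' u)"
| "db_step u u' \<Longrightarrow> db_step (DApp t u) (DApp t u')"
| "db_step p p' \<Longrightarrow> db_step (DLam n p s) (DLam n p' s)"
| "db_step s s' \<Longrightarrow> db_step (DLam n p s) (DLam n p s')"


section \<open>Backward translation\<close>

definition syms_of :: "'a list list \<Rightarrow> 'a set" where
  "syms_of V = (\<Union>\<theta> \<in> set V. set \<theta>)"

text \<open>Indices count from 1, list positions from 0. The choice of the fresh symbols is immaterial
  because the result is a term modulo \<open>alpha\<close>.\<close>

primrec back_tr :: "'a list list \<Rightarrow> 'a list list \<Rightarrow> db \<Rightarrow> 'a ppc" where
  "back_tr V M (DVar i j) = PVar (V ! (i - 1) ! (j - 1))"
| "back_tr V M (DMat i j) = PMat (M ! (i - 1) ! (j - 1))"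
| "back_tr V M (DApp t u) = PApp (back_tr V M t) (back_tr V M u)"
| "back_tr V M (DLam n p s) =
     (let \<theta> = (SOME \<theta>. length \<theta> = n \<and> distinct \<theta> \<and> set \<theta> \<inter> (syms_of V \<union> syms_of M) = {})
      in PLam \<theta> (back_tr V (\<theta> # M) p) (back_tr (\<theta> # V) M s))"

text \<open>The enumeration is used at the arguments 1, 2, ... only. Any \<open>n\<close> that covers the free indices
  may be taken; one exists for every well-formed term, and the result does not depend on it.\<close>

definition backward :: "(nat \<Rightarrow> 'a) \<Rightarrow> db \<Rightarrow> 'a ppc" where
  "backward x t =
     (let n = (SOME n. fv t \<union> fm t \<subseteq> {1..n} \<times> {1});
          X = map (\<lambda>i. [x i]) [1..<n + 1]
      in back_tr X X t)"

end

theory Submission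
  imports Defs
begin

text \<open>
  A preterm is read back as a de Bruijn term, given injective assignments of indices to its free
  variables and free matchables. For preterms whose binders list distinct symbols, two preterms
  with the same reading are alpha-convertible, and the reading turns matching and substitution
  of PPC into those of the de Bruijn calculus. Hence every step of the reading is the reading of a
  step of the preterm. The backward translation produces a preterm that is read back as the
  term it came from, so both ends of the step are determined by their readings.
\<close>

section \<open>Reading a preterm as a de Bruijn term\<close>

text \<open>Positions count from 1, as secondary indices do; an absent symbol gets
  \<open>length \<theta> + 1\<close>, so the value is always positive.\<close>

primrec pos :: "'a list \<Rightarrow> 'a \<Rightarrow> nat" where
  "pos [] x = 1"
| "pos (y # ys) x = (if x = y then 1 else Suc (pos ys x))"

lemma pos_ge_1 [simp]: "Suc 0 \<le> pos \<theta> x"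
  by (induction \<theta>) auto

lemma pos_gt_0 [simp]: "0 < pos \<theta> x"
  using pos_ge_1 by (rule Suc_le_lessD)

lemma pos_le_length: "x \<in> set \<theta> \<Longrightarrow> pos \<theta> x \<le> length \<theta>"
  by (induction \<theta>) auto

lemma nth_pos: "x \<in> set \<theta> \<Longrightarrow> \<theta> ! (pos \<theta> x - 1) = x"
proof (induction \<theta>)
  case (Cons y ys)
  then show ?case
    by (cases "pos ys x") (use pos_ge_1[of ys x] in auto)
qed simp

lemma pos_nth: "distinct \<theta> \<Longrightarrow> k < length \<theta> \<Longrightarrow> pos \<theta> (\<theta> ! k) = Suc k"
proof (induction \<theta> arbitrary: k)
  case (Cons y ys)
  then show ?case
    by (cases k) auto
qed simp

lemma inj_on_pos: "inj_on (pos \<theta>) (set \<theta>)"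
  by (metis inj_onI nth_pos)

lemma pos_image:
  assumes "distinct \<theta>"
  shows "pos \<theta> ` set \<theta> = {1..length \<theta>}"
proof -
  have "j \<in> pos \<theta> ` set \<theta>" if "1 \<le> j" "j \<le> length \<theta>" for j
  proof -
    from that have "j = pos \<theta> (\<theta> ! (j - 1))"
      using assms by (simp add: pos_nth)
    moreover have "\<theta> ! (j - 1) \<in> set \<theta>"
      using that by simp
    ultimately show ?thesis
      by blast
  qed
  then show ?thesis
    using pos_le_length[of _ \<theta>] by (intro equalityI subsetI) auto
qed

lemma pos_map: "inj_on f (set \<theta>) \<Longrightarrow> x \<in> set \<theta> \<Longrightarrow> pos (map f \<theta>) (f x) = pos \<theta> x"
  by (induction \<theta>) (auto simp: inj_on_def)

text \<open>The index assignment inside a binder. It serves both kinds of symbols: a binder pushes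
  onto the matchables in its pattern and onto the variables in its body.\<close>

definition push :: "'a list \<Rightarrow> ('a \<Rightarrow> nat \<times> nat) \<Rightarrow> 'a \<Rightarrow> nat \<times> nat" where
  "push \<theta> e x = (if x \<in> set \<theta> then (1, pos \<theta> x) else (fst (e x) + 1, snd (e x)))"

text \<open>Injectivity recovers a symbol from its index. The bound on primary indices keeps outer
  symbols away from level 1 after a \<open>push\<close>, which preserves injectivity under
  binders.\<close>

definition index_env :: "('a \<Rightarrow> nat \<times> nat) \<Rightarrow> bool" where
  "index_env e \<longleftrightarrow> inj e \<and> (\<forall>x. 1 \<le> fst (e x) \<and> 1 \<le> snd (e x))"

lemma index_env_ge_1: "index_env e \<Longrightarrow> 1 \<le> fst (e x) \<and> 1 \<le> snd (e x)"
  by (simp add: index_env_def)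

lemma index_env_push [simp]:
  assumes "index_env e"
  shows "index_env (push \<theta> e)"
proof -
  have "x = y" if "push \<theta> e x = push \<theta> e y" for x y
  proof (cases "x \<in> set \<theta>"; cases "y \<in> set \<theta>")
    assume "x \<in> set \<theta>" "y \<in> set \<theta>"
    then show ?thesis
      using that inj_on_pos[of \<theta>] by (simp add: push_def inj_on_def)
  next
    assume "x \<notin> set \<theta>" "y \<notin> set \<theta>"
    then have "e x = e y"
      using that by (simp add: push_def prod_eq_iff)
    then show ?thesis
      using assms by (simp add: index_env_def inj_eq)
  qed (use that index_env_ge_1[OF assms, of x] index_env_ge_1[OF assms, of y]
        in \<open>simp_all add: push_def\<close>)
  then show ?thesis
    using assms by (auto simp: index_env_def inj_def push_def Suc_le_eq)
qed

primrec nameless :: "('a \<Rightarrow> nat \<times> nat) \<Rightarrow> ('a \<Rightarrow> nat \<times> nat) \<Rightarrow> 'a preterm \<Rightarrow> db" where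
  "nameless ev em (Var x) = DVar (fst (ev x)) (snd (ev x))"
| "nameless ev em (Mat x) = DMat (fst (em x)) (snd (em x))"
| "nameless ev em (App t u) = DApp (nameless ev em t) (nameless ev em u)"
| "nameless ev em (Lam \<theta> p s) =
     DLam (length \<theta>) (nameless ev (push \<theta> em) p) (nameless (push \<theta> ev) em s)"

lemma nameless_cong:
  "(\<And>x. x \<in> syms t \<Longrightarrow> ev x = ev' x) \<Longrightarrow> (\<And>x. x \<in> syms t \<Longrightarrow> em x = em' x) \<Longrightarrow>
     nameless ev em t = nameless ev' em' t"
proof (induction t arbitrary: ev em ev' em')
  case (App t u)
  have "nameless ev em t = nameless ev' em' t" "nameless ev em u = nameless ev' em' u"
    by (rule App.IH; simp add: App.prems)+
  then show ?case
    by simp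
next
  case (Lam \<theta> p s)
  have "nameless ev (push \<theta> em) p = nameless ev' (push \<theta> em') p"
    by (rule Lam.IH(1)) (simp_all add: Lam.prems push_def)
  moreover have "nameless (push \<theta> ev) em s = nameless (push \<theta> ev') em' s"
    by (rule Lam.IH(2)) (simp_all add: Lam.prems push_def)
  ultimately show ?case
    by simp
qed simp_all

text \<open>If \<open>b\<close> occurs in neither \<open>p\<close> nor \<open>s\<close>, then
  \<open>Lam [a, a] p s\<close> and \<open>Lam [a, b] p s\<close> have the same reading without
  being alpha-convertible. Distinct binder lists exclude this.\<close>

primrec distinct_binders :: "'a preterm \<Rightarrow> bool" where
  "distinct_binders (Var x) \<longleftrightarrow> True"
| "distinct_binders (Mat x) \<longleftrightarrow> True"
| "distinct_binders (App t u) \<longleftrightarrow> distinct_binders t \<and> distinct_binders u"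
| "distinct_binders (Lam \<theta> p s) \<longleftrightarrow> distinct \<theta> \<and> distinct_binders p \<and> distinct_binders s"

lemma distinct_binders_ren_v [simp]: "distinct_binders (ren_v f t) = distinct_binders t"
  by (induction t arbitrary: f) auto

lemma distinct_binders_ren_m [simp]: "distinct_binders (ren_m f t) = distinct_binders t"
  by (induction t arbitrary: f) auto

text \<open>\<open>syms\<close> includes the binder lists, so a moved symbol lands outside every
  binder of \<open>t\<close> and is not captured. Below a binder \<open>override_on\<close> only
  resets symbols to themselves, so the hypothesis persists.\<close>

lemma nameless_ren_v:
  "(\<And>x. x \<in> syms t \<Longrightarrow> f x = x \<or> f x \<notin> syms t) \<Longrightarrow>
     nameless ev em (ren_v f t) = nameless (ev \<circ> f) em t"
proof (induction t arbitrary: f ev em)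
  case (App t u)
  have "nameless ev em (ren_v f t) = nameless (ev \<circ> f) em t"
    by (rule App.IH) (use App.prems in auto)
  moreover have "nameless ev em (ren_v f u) = nameless (ev \<circ> f) em u"
    by (rule App.IH) (use App.prems in auto)
  ultimately show ?case
    by (simp add: comp_def)
next
  case (Lam \<theta> p s)
  let ?h = "override_on f id (set \<theta>)"
  have p: "nameless ev (push \<theta> em) (ren_v f p) = nameless (ev \<circ> f) (push \<theta> em) p"
    by (rule Lam.IH) (use Lam.prems in auto)
  have "nameless (push \<theta> ev) em (ren_v ?h s) = nameless (push \<theta> ev \<circ> ?h) em s"
    by (rule Lam.IH) (use Lam.prems in \<open>auto simp: override_on_def\<close>)
  also have "\<dots> = nameless (push \<theta> (ev \<circ> f)) em s"
  proof (rule nameless_cong)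
    fix x assume "x \<in> syms s"
    then show "(push \<theta> ev \<circ> ?h) x = push \<theta> (ev \<circ> f) x"
      using Lam.prems[of x] by (auto simp: push_def override_on_def)
  qed simp
  finally show ?case
    using p by (simp add: comp_def)
qed simp_all

lemma nameless_ren_m:
  "(\<And>x. x \<in> syms t \<Longrightarrow> f x = x \<or> f x \<notin> syms t) \<Longrightarrow>
     nameless ev em (ren_m f t) = nameless ev (em \<circ> f) t"
proof (induction t arbitrary: f ev em)
  case (App t u)
  have "nameless ev em (ren_m f t) = nameless ev (em \<circ> f) t"
    by (rule App.IH) (use App.prems in auto)
  moreover have "nameless ev em (ren_m f u) = nameless ev (em \<circ> f) u"
    by (rule App.IH) (use App.prems in auto)
  ultimately show ?case
    by (simp add: comp_def)
next
  case (Lam \<theta> p s)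
  let ?h = "override_on f id (set \<theta>)"
  have s: "nameless (push \<theta> ev) em (ren_m f s) = nameless (push \<theta> ev) (em \<circ> f) s"
    by (rule Lam.IH) (use Lam.prems in auto)
  have "nameless ev (push \<theta> em) (ren_m ?h p) = nameless ev (push \<theta> em \<circ> ?h) p"
    by (rule Lam.IH) (use Lam.prems in \<open>auto simp: override_on_def\<close>)
  also have "\<dots> = nameless ev (push \<theta> (em \<circ> f)) p"
  proof (rule nameless_cong)
    fix x assume "x \<in> syms p"
    then show "(push \<theta> em \<circ> ?h) x = push \<theta> (em \<circ> f) x"
      using Lam.prems[of x] by (auto simp: push_def override_on_def)
  qed simp
  finally show ?case
    using s by (simp add: comp_def)
qed simp_all

text \<open>Binder symbols keep their positions because \<open>f\<close> is injective on them; the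
  other symbols of \<open>A\<close> are not captured, since \<open>map f \<theta>\<close> avoids
  \<open>A\<close>.\<close>

lemma push_map_override_on:
  assumes "fresh_ren f \<theta> A" "x \<in> A"
  shows "push (map f \<theta>) e (override_on id f (set \<theta>) x) = push \<theta> e x"
  using assms by (auto simp: push_def override_on_def fresh_ren_def pos_map)

text \<open>\<open>A\<close> may exceed \<open>syms s\<close>: alpha-conversion avoids pattern and
  body together, and \<open>psubst\<close> avoids the substitution as well.\<close>

lemma nameless_ren_v_binder:
  assumes "fresh_ren f \<theta> A" "syms s \<subseteq> A"
  shows "nameless (push (map f \<theta>) ev) em (ren_v (override_on id f (set \<theta>)) s) =
         nameless (push \<theta> ev) em s"
proof (subst nameless_ren_v)
  show "override_on id f (set \<theta>) x = x \<or> override_on id f (set \<theta>) x \<notin> syms s"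
    for x
    using assms by (auto simp: override_on_def fresh_ren_def)
qed (intro nameless_cong, use assms push_map_override_on in fastforce, simp)

lemma nameless_ren_m_binder:
  assumes "fresh_ren f \<theta> A" "syms p \<subseteq> A"
  shows "nameless ev (push (map f \<theta>) em) (ren_m (override_on id f (set \<theta>)) p) =
         nameless ev (push \<theta> em) p"
proof (subst nameless_ren_m)
  show "override_on id f (set \<theta>) x = x \<or> override_on id f (set \<theta>) x \<notin> syms p"
    for x
    using assms by (auto simp: override_on_def fresh_ren_def)
qed (intro nameless_cong, simp, use assms push_map_override_on in fastforce)

section \<open>Equal readings are alpha-convertible\<close>

lemma finite_syms [simp]: "finite (syms t)"
  by (induction t) auto

lemma ex_fresh_list:
  assumes "infinite (UNIV :: 'a set)" "finite (A :: 'a set)"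
  shows "\<exists>zs. length zs = n \<and> distinct zs \<and> set zs \<inter> A = {}"
proof -
  have "infinite (- A)"
    using assms by (simp add: Compl_eq_Diff_UNIV)
  then obtain B where "finite B" "card B = n" "B \<subseteq> - A"
    by (meson infinite_arbitrarily_large)
  moreover obtain zs where "set zs = B" "distinct zs"
    using \<open>finite B\<close> finite_distinct_list by blast
  ultimately show ?thesis
    by (intro exI[of _ zs]) (auto simp: distinct_card)
qed

lemma ex_map_eq:
  "length \<theta> = length zs \<Longrightarrow> distinct \<theta> \<Longrightarrow> \<exists>f. map f \<theta> = zs"
proof (induction \<theta> zs rule: list_induct2)
  case (Cons y ys z zs)
  then obtain f where "map f ys = zs"
    by auto
  then have "map (f(y := z)) (y # ys) = z # zs"
    using Cons.prems by simp
  then show ?case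
    by (intro exI[of _ "f(y := z)"])
qed simp

lemma ex_fresh_ren:
  assumes "infinite (UNIV :: 'a set)" "finite (A :: 'a set)"
  shows "\<exists>f. fresh_ren f \<theta> A"
proof -
  \<comment> \<open>\<open>\<theta>\<close> may repeat symbols, while \<open>ex_map_eq\<close> asks
    for a distinct list. \<open>fresh_ren\<close> depends on \<open>\<theta>\<close> only through
    \<open>set \<theta>\<close>, which \<open>remdups\<close> preserves.\<close>
  obtain zs where "length zs = length (remdups \<theta>)" "distinct zs" "set zs \<inter> A = {}"
    using ex_fresh_list[OF assms] by blast
  moreover from this obtain f where "map f (remdups \<theta>) = zs"
    using ex_map_eq[of "remdups \<theta>" zs] by auto
  ultimately have "fresh_ren f \<theta> A"
    using distinct_map[of f "remdups \<theta>"] set_map[of f "remdups \<theta>"] by (simp add: fresh_ren_def)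
  then show ?thesis
    by (intro exI[of _ f])
qed

lemma ex_rebind:
  assumes "distinct \<theta>" "length \<theta> = length zs" "distinct zs" "set zs \<inter> A = {}"
  shows "\<exists>f. fresh_ren f \<theta> A \<and> map f \<theta> = zs"
proof -
  obtain f where "map f \<theta> = zs"
    using assms ex_map_eq by blast
  then show ?thesis
    using assms by (metis distinct_map fresh_ren_def set_map)
qed

text \<open>Two binders become comparable once both are renamed to a common list \<open>zs\<close>
  fresh for both terms: their patterns and bodies are then read in the same environments. Renamed
  parts are not subterms but keep their size, hence the induction on size.\<close>

lemma alpha_if_nameless_eq:
  assumes inf: "infinite (UNIV :: 'a set)"
  shows "nameless ev em (t :: 'a preterm) = nameless ev em t' \<Longrightarrow>
    distinct_binders t \<Longrightarrow> distinct_binders t' \<Longrightarrow> index_env ev \<Longrightarrow> index_env em \<Longrightarrow> alpha t t'"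
proof (induction "size t" arbitrary: t t' ev em rule: less_induct)
  case less
  show ?case
  proof (cases t)
    case (Var x)
    with less.prems show ?thesis
      by (cases t') (auto simp: index_env_def prod_eq_iff[symmetric] inj_eq intro: alpha_refl)
  next
    case (Mat x)
    with less.prems show ?thesis
      by (cases t') (auto simp: index_env_def prod_eq_iff[symmetric] inj_eq intro: alpha_refl)
  next
    case (App a b)
    with less.prems obtain a' b' where t': "t' = App a' b'"
      by (cases t') auto
    have "alpha a a'" "alpha b b'"
      by (rule less.hyps[of _ ev em]; use less.prems App t' in simp)+
    then show ?thesis
      unfolding App t' by (rule alpha_App)
  next
    case (Lam \<theta> p s)
    with less.prems obtain \<theta>' p' s' where t': "t' = Lam \<theta>' p' s'"
      by (cases t') auto
    let ?A = "syms p \<union> syms s" and ?A' = "syms p' \<union> syms s'"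
    obtain zs where zs: "length zs = length \<theta>" "distinct zs" "set zs \<inter> (?A \<union> ?A') = {}"
      using ex_fresh_list[OF inf, of "?A \<union> ?A'" "length \<theta>"] by auto
    obtain f where f: "fresh_ren f \<theta> ?A" "map f \<theta> = zs"
      using ex_rebind[of \<theta> zs ?A] zs less.prems Lam by auto
    obtain f' where f': "fresh_ren f' \<theta>' ?A'" "map f' \<theta>' = zs"
      using ex_rebind[of \<theta>' zs ?A'] zs less.prems Lam t' by auto
    let ?g = "override_on id f (set \<theta>)" and ?g' = "override_on id f' (set \<theta>')"
    have "alpha (ren_m ?g p) (ren_m ?g' p')"
    proof (rule less.hyps)
      show "nameless ev (push zs em) (ren_m ?g p) = nameless ev (push zs em) (ren_m ?g' p')"
        using nameless_ren_m_binder[OF f(1), of p] nameless_ren_m_binder[OF f'(1), of p'] f f'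
          less.prems Lam t' by simp
    qed (use less.prems Lam t' in simp_all)
    moreover have "alpha (ren_v ?g s) (ren_v ?g' s')"
    proof (rule less.hyps)
      show "nameless (push zs ev) em (ren_v ?g s) = nameless (push zs ev) em (ren_v ?g' s')"
        using nameless_ren_v_binder[OF f(1), of s] nameless_ren_v_binder[OF f'(1), of s'] f f'
          less.prems Lam t' by simp
    qed (use less.prems Lam t' in simp_all)
    ultimately have "alpha (rebind f \<theta> p s) (rebind f' \<theta>' p' s')"
      using f f' by (simp add: rebind_def alpha_Lam)
    then show ?thesis
      unfolding Lam t'
      using alpha_conv[OF f(1)] alpha_conv[OF f'(1)] alpha_sym alpha_trans by blast
  qed
qed

section \<open>Reading substitutions\<close>

text \<open>The effect of \<open>inc_v k\<close> or \<open>inc_m k\<close> on a single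
  index.\<close>

definition shift :: "nat \<Rightarrow> nat \<times> nat \<Rightarrow> nat \<times> nat" where
  "shift k a = (if fst a > k then (fst a + 1, snd a) else a)"

lemma push_shift: "push \<theta> (\<lambda>x. shift k (e x)) = (\<lambda>x. shift (k + 1) (push \<theta> e x))"
  by (auto simp: push_def shift_def)

lemma nameless_shift_v: "nameless (\<lambda>x. shift k (ev x)) em t = inc_v k (nameless ev em t)"
  by (induction t arbitrary: ev em k) (simp_all add: push_shift, simp add: shift_def)

lemma nameless_shift_m: "nameless ev (\<lambda>x. shift k (em x)) t = inc_m k (nameless ev em t)"
  by (induction t arbitrary: ev em k) (simp_all add: push_shift, simp add: shift_def)

lemma push_fresh: "index_env e \<Longrightarrow> x \<notin> set \<theta> \<Longrightarrow> push \<theta> e x = shift 0 (e x)"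
  using index_env_ge_1[of e x] by (simp add: push_def shift_def)

text \<open>On symbols outside \<open>\<theta>\<close> a push is just \<open>shift 0\<close>. This
  accounts for the increments that \<open>dsubst\<close> applies to the inserted terms when it
  crosses a binder.\<close>

lemma nameless_push_v:
  assumes "set \<theta> \<inter> syms t = {}" "index_env ev"
  shows "nameless (push \<theta> ev) em t = inc_v 0 (nameless ev em t)"
  unfolding nameless_shift_v[symmetric]
  by (rule nameless_cong) (use assms push_fresh in \<open>fastforce+\<close>)

lemma nameless_push_m:
  assumes "set \<theta> \<inter> syms t = {}" "index_env em"
  shows "nameless ev (push \<theta> em) t = inc_m 0 (nameless ev em t)"
  unfolding nameless_shift_m[symmetric]
  by (rule nameless_cong) (use assms push_fresh in \<open>fastforce+\<close>)

lemma inc_v_inc_m: "inc_m l (inc_v k t) = inc_v k (inc_m l t)"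
  by (induction t arbitrary: k l) auto

lemma inc_v_inc_v: "l \<le> k \<Longrightarrow> inc_v l (inc_v k t) = inc_v (k + 1) (inc_v l t)"
  by (induction t arbitrary: k l) auto

lemma dec_v_inc_v [simp]: "dec_v k (inc_v k t) = t"
  by (induction t arbitrary: k) auto


text \<open>Replaces the choice inside \<open>psubst\<close> by some fresh \<open>f\<close>, which
  exists because \<open>A\<close> is finite; later arguments rely on freshness alone.\<close>

lemma psubst_LamE:
  assumes "infinite (UNIV :: 'a set)"
    and A: "A = syms p \<union> syms s \<union> fmdom' \<tau> \<union> (\<Union>u \<in> fmran' \<tau>. syms u)"
  obtains f where "fresh_ren f \<theta> (A :: 'a set)"
    "psubst \<tau> (Lam \<theta> p s) = Lam (map f \<theta>)
       (psubst \<tau> (ren_m (override_on id f (set \<theta>)) p))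
       (psubst \<tau> (ren_v (override_on id f (set \<theta>)) s))"
proof -
  have "finite A"
    by (simp add: A fmran'_alt_def)
  from someI_ex[OF ex_fresh_ren[OF assms(1) this, of \<theta>]] show thesis
    by (rule that) (simp only: psubst.simps Let_def A)
qed

declare psubst.simps(4) [simp del]

text \<open>
  The level \<open>k + 1\<close> is the one substituted. \<open>ev'\<close> reads the term before the substitution, where
  the symbols in the domain of \<open>\<tau>\<close> have primary index \<open>k + 1\<close>, and \<open>ev\<close> the result, where this
  level is gone.
\<close>

lemma nameless_psubst:
  assumes inf: "infinite (UNIV :: 'a set)"
  shows "(\<And>x u. fmlookup \<tau> x = Some u \<Longrightarrow>
             fst (ev' x) = k + 1 \<and> fmlookup \<sigma> (snd (ev' x)) = Some (inc_v k (nameless ev em u))) \<Longrightarrow>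
         (\<And>x. fmlookup \<tau> x = None \<Longrightarrow> ev' x = shift k (ev x)) \<Longrightarrow>
         index_env ev \<Longrightarrow> index_env em \<Longrightarrow>
         nameless ev em (psubst \<tau> (t :: 'a preterm)) =
           dec_v k (dsubst (k + 1) \<sigma> (nameless ev' em t))"
proof (induction "size t" arbitrary: t k \<sigma> ev ev' em rule: less_induct)
  case less
  show ?case
  proof (cases t)
    case (Var x)
    show ?thesis
    proof (cases "fmlookup \<tau> x")
      \<comment> \<open>\<open>shift k (ev x)\<close> never has primary index \<open>k + 1\<close>,
        so \<open>dsubst\<close> leaves the variable alone and \<open>dec_v k\<close> undoes the
        shift.\<close>
      case None
      then show ?thesis
        using Var less.prems(2)[OF None] by (auto simp: shift_def)
    next
      \<comment> \<open>\<open>dsubst\<close> inserts the reading of \<open>u\<close> under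
        \<open>inc_v k\<close>, and \<open>dec_v k\<close> cancels that increment.\<close>
      case (Some u)
      then show ?thesis
        using Var less.prems(1)[OF Some] by simp
    qed
  next
    case (Mat x)
    then show ?thesis
      by simp
  next
    case (App a b)
    have "nameless ev em (psubst \<tau> a) = dec_v k (dsubst (k + 1) \<sigma> (nameless ev' em a))"
      "nameless ev em (psubst \<tau> b) = dec_v k (dsubst (k + 1) \<sigma> (nameless ev' em b))"
      by (rule less.hyps; use less.prems App in simp)+
    then show ?thesis
      using App by simp
  next
    case (Lam \<theta> p s)
    define A where "A = syms p \<union> syms s \<union> fmdom' \<tau> \<union> (\<Union>u \<in> fmran' \<tau>. syms u)"
    obtain f where f: "fresh_ren f \<theta> A" and psubst: "psubst \<tau> t =
        Lam (map f \<theta>) (psubst \<tau> (ren_m (override_on id f (set \<theta>)) p))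
          (psubst \<tau> (ren_v (override_on id f (set \<theta>)) s))"
      unfolding Lam using psubst_LamE[OF inf A_def] .
    define zs where "zs = map f \<theta>"
    let ?g = "override_on id f (set \<theta>)"
    have zs_A: "set zs \<inter> A = {}"
      using f by (simp add: fresh_ren_def zs_def)
    have fresh_dom: "x \<notin> set zs" if "fmlookup \<tau> x = Some u" for x u
      using zs_A that by (auto simp: A_def fmdom'I)
    have fresh_ran: "set zs \<inter> syms u = {}" if "fmlookup \<tau> x = Some u" for x u
      using zs_A that by (auto simp: A_def fmran'I)
    \<comment> \<open>In the pattern the level stays \<open>k + 1\<close> and only the matchable
      environment grows. Inserted terms contain no symbol of \<open>zs\<close>, so their readings
      gain \<open>inc_m 0\<close>.\<close>
    have "nameless ev (push zs em) (psubst \<tau> (ren_m ?g p)) =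
        dec_v k (dsubst (k + 1) (fmmap (inc_m 0) \<sigma>) (nameless ev' (push zs em) (ren_m ?g p)))"
    proof (rule less.hyps)
      fix x u assume x: "fmlookup \<tau> x = Some u"
      show "fst (ev' x) = k + 1 \<and> fmlookup (fmmap (inc_m 0) \<sigma>) (snd (ev' x)) =
          Some (inc_v k (nameless ev (push zs em) u))"
        using less.prems(1)[OF x] less.prems(4) nameless_push_m[OF fresh_ran[OF x]]
        by (simp add: inc_v_inc_m)
    qed (use less.prems Lam in simp_all)
    also have "nameless ev' (push zs em) (ren_m ?g p) = nameless ev' (push \<theta> em) p"
      unfolding zs_def by (rule nameless_ren_m_binder[OF f]) (auto simp: A_def)
    finally have p: "nameless ev (push zs em) (psubst \<tau> (ren_m ?g p)) =
        dec_v k (dsubst (k + 1) (fmmap (inc_m 0) \<sigma>) (nameless ev' (push \<theta> em) p))" .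
    \<comment> \<open>In the body the level rises by one: the domain of \<open>\<tau>\<close> avoids
      \<open>zs\<close>, so its symbols move to primary index \<open>k + 2\<close>. Inserted
      readings gain \<open>inc_v 0\<close>, exchanged with \<open>inc_v k\<close> by
      \<open>inc_v_inc_v\<close>.\<close>
    have "nameless (push zs ev) em (psubst \<tau> (ren_v ?g s)) =
        dec_v (k + 1) (dsubst (k + 1 + 1) (fmmap (inc_v 0) \<sigma>)
          (nameless (push zs ev') em (ren_v ?g s)))"
    proof (rule less.hyps)
      fix x u assume x: "fmlookup \<tau> x = Some u"
      have "push zs ev' x = (k + 1 + 1, snd (ev' x))"
        using less.prems(1)[OF x] fresh_dom[OF x] by (simp add: push_def)
      then show "fst (push zs ev' x) = k + 1 + 1 \<and>
          fmlookup (fmmap (inc_v 0) \<sigma>) (snd (push zs ev' x)) =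
          Some (inc_v (k + 1) (nameless (push zs ev) em u))"
        using less.prems(1)[OF x] less.prems(3) nameless_push_v[OF fresh_ran[OF x]]
        by (simp add: inc_v_inc_v)
    next
      fix x assume "fmlookup \<tau> x = None"
      then show "push zs ev' x = shift (k + 1) (push zs ev x)"
        using less.prems(2)[of x] by (auto simp: push_def shift_def)
    qed (use less.prems Lam in simp_all)
    also have "nameless (push zs ev') em (ren_v ?g s) = nameless (push \<theta> ev') em s"
      unfolding zs_def by (rule nameless_ren_v_binder[OF f]) (auto simp: A_def)
    finally have "nameless (push zs ev) em (psubst \<tau> (ren_v ?g s)) =
        dec_v (k + 1) (dsubst (k + 1 + 1) (fmmap (inc_v 0) \<sigma>) (nameless (push \<theta> ev') em s))" .
    with p show ?thesis
      unfolding psubst unfolding Lam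
      by (simp only: zs_def nameless.simps dsubst.simps dec_v.simps length_map)
  qed
qed

lemma distinct_binders_psubst:
  assumes inf: "infinite (UNIV :: 'a set)"
    and ran: "\<And>x u. fmlookup \<tau> x = Some u \<Longrightarrow> distinct_binders u"
  shows "distinct_binders t \<Longrightarrow> distinct_binders (psubst \<tau> (t :: 'a preterm))"
proof (induction "size t" arbitrary: t rule: less_induct)
  case less
  show ?case
  proof (cases t)
    case (Var x)
    then show ?thesis
      using ran by (auto split: option.split)
  next
    case (Lam \<theta> p s)
    obtain f where f: "fresh_ren f \<theta> (syms p \<union> syms s \<union> fmdom' \<tau> \<union> (\<Union>u \<in> fmran' \<tau>. syms u))"
      and "psubst \<tau> t =
        Lam (map f \<theta>) (psubst \<tau> (ren_m (override_on id f (set \<theta>)) p))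
          (psubst \<tau> (ren_v (override_on id f (set \<theta>)) s))"
      unfolding Lam using psubst_LamE[OF inf refl] .
    moreover have "distinct (map f \<theta>)"
      using f less.prems Lam by (simp add: fresh_ren_def distinct_map)
    ultimately show ?thesis
      using less Lam by simp
  qed (use less in simp_all)
qed

section \<open>Reading matches\<close>

lemma ddata_inc_v [simp]: "ddata (inc_v k t) = ddata t"
  by (induction t) auto

lemma ddata_nameless [simp]: "ddata (nameless ev em t) = data t"
  by (induction t) auto

lemma dmform_nameless [simp]: "dmform (nameless ev em t) = mform t"
  by (cases t) (auto simp: dmform_def mform_def)

lemma dmform_inc_v [simp]: "dmform (inc_v k t) = dmform t"
  by (cases t) (auto simp: dmform_def)

text \<open>Values carry \<open>inc_v 0\<close> because the de Bruijn rule matches against the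
  incremented argument. The domain need only lie in \<open>set \<theta>\<close>, since partial
  results of matching are compared before the domain check.\<close>

fun match_reading ::
    "('a \<Rightarrow> nat \<times> nat) \<Rightarrow> ('a \<Rightarrow> nat \<times> nat) \<Rightarrow> 'a list \<Rightarrow>
     ('a, 'a preterm) mtch \<Rightarrow> (nat, db) mtch \<Rightarrow> bool" where
  "match_reading ev em \<theta> (Subst \<tau>) (Subst \<sigma>) \<longleftrightarrow>
     fmdom' \<tau> \<subseteq> set \<theta> \<and> fmdom' \<sigma> = pos \<theta> ` fmdom' \<tau> \<and>
     (\<forall>x u. fmlookup \<tau> x = Some u \<longrightarrow>
        distinct_binders u \<and> fmlookup \<sigma> (pos \<theta> x) = Some (inc_v 0 (nameless ev em u)))"
| "match_reading ev em \<theta> Fail Fail \<longleftrightarrow> True"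
| "match_reading ev em \<theta> Wait Wait \<longleftrightarrow> True"
| "match_reading ev em \<theta> _ _ \<longleftrightarrow> False"

text \<open>\<open>pos \<theta>\<close> is injective on \<open>set \<theta>\<close>, so the domains
  meet on one side exactly when they meet on the other, and the two joins fail together.\<close>

lemma match_reading_join:
  assumes "match_reading ev em \<theta> \<mu> \<nu>" "match_reading ev em \<theta> \<mu>' \<nu>'"
  shows "match_reading ev em \<theta> (join \<mu> \<mu>') (join \<nu> \<nu>')"
proof (cases "\<exists>\<tau> \<tau>'. \<mu> = Subst \<tau> \<and> \<mu>' = Subst \<tau>'")
  case True
  then obtain \<tau> \<tau>' where \<mu>: "\<mu> = Subst \<tau>" "\<mu>' = Subst \<tau>'"
    by blast
  then obtain \<sigma> \<sigma>' where \<nu>: "\<nu> = Subst \<sigma>" "\<nu>' = Subst \<sigma>'"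
    using assms by (cases \<nu>; cases \<nu>') auto
  have \<tau>: "fmdom' \<tau> \<subseteq> set \<theta>" "fmdom' \<tau>' \<subseteq> set \<theta>"
    and \<sigma>: "fmdom' \<sigma> = pos \<theta> ` fmdom' \<tau>" "fmdom' \<sigma>' = pos \<theta> ` fmdom' \<tau>'"
    using assms unfolding \<mu> \<nu> by simp_all
  have inter: "fmdom' \<sigma> \<inter> fmdom' \<sigma>' = pos \<theta> ` (fmdom' \<tau> \<inter> fmdom' \<tau>')"
    unfolding \<sigma> using inj_on_image_Int[OF inj_on_pos \<tau>] by simp
  show ?thesis
  proof (cases "fmdom' \<tau> \<inter> fmdom' \<tau>' = {}")
    case False
    then show ?thesis
      using inter by (simp add: \<mu> \<nu>)
  next
    case disj: True
    \<comment> \<open>\<open>++\<^sub>f\<close> prefers its right argument, hence the split on the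
      domain of \<open>\<tau>'\<close>. If \<open>x\<close> is outside it, disjointness keeps
      \<open>pos \<theta> x\<close> out of the domain of \<open>\<sigma>'\<close>.\<close>
    have "fmlookup (\<sigma> ++\<^sub>f \<sigma>') (pos \<theta> x) = Some (inc_v 0 (nameless ev em u)) \<and> distinct_binders u"
      if x: "fmlookup (\<tau> ++\<^sub>f \<tau>') x = Some u" for x u
    proof (cases "x \<in> fmdom' \<tau>'")
      case True
      then have "fmlookup \<tau>' x = Some u"
        using x by (simp add: fmdom'_alt_def split: if_splits)
      moreover have "pos \<theta> x \<in> fmdom' \<sigma>'"
        using True \<sigma> by simp
      ultimately show ?thesis
        using assms by (simp add: \<mu> \<nu> fmdom'_alt_def)
    next
      case False
      then have "fmlookup \<tau> x = Some u"
        using x by (simp add: fmdom'_alt_def split: if_splits)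
      moreover from this have "x \<in> fmdom' \<tau>"
        by (rule fmdom'I)
      then have "pos \<theta> x \<notin> fmdom' \<sigma>'"
        using \<sigma> inter disj by blast
      ultimately show ?thesis
        using assms by (simp add: \<mu> \<nu> fmdom'_alt_def)
    qed
    then show ?thesis
      using disj inter \<tau> \<sigma> by (auto simp: \<mu> \<nu> image_Un)
  qed
next
  case False
  then show ?thesis
    using assms by (cases \<mu>; cases \<nu>; cases \<mu>'; cases \<nu>') auto
qed

text \<open>Reading and incrementing preserve and reflect matchable forms, so the same clause of
  matching applies on both sides.\<close>

lemma match_reading_pre_match:
  assumes em: "index_env em"
  shows "distinct_binders u \<Longrightarrow> match_reading ev em \<theta> (pre_match \<theta> p u)
     (pre_dmatch (nameless ev (push \<theta> em) p) (inc_v 0 (nameless ev em u)))"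
proof (induction p arbitrary: u)
  case (Mat x)
  show ?case
  proof (cases "x \<in> set \<theta>")
    case True
    then show ?thesis
      using Mat by (simp add: push_def)
  next
    case False
    \<comment> \<open>The equivalence uses injectivity of \<open>em\<close>. \<open>push\<close> has
      raised the primary index of the pattern symbol by one, and \<open>pre_dmatch\<close> subtracts
      it again.\<close>
    have "inc_v 0 (nameless ev em u) = DMat (fst (em x)) (snd (em x)) \<longleftrightarrow> u = Mat x"
      using em by (cases u) (auto simp: index_env_def prod_eq_iff[symmetric] inj_eq)
    then show ?thesis
      using False index_env_ge_1[OF em, of x] by (simp add: push_def)
  qed
next
  case (App p q)
  show ?case
  proof (cases u)
    case u: (App a b)
    have "match_reading ev em \<theta> (join (pre_match \<theta> p a) (pre_match \<theta> q b))
      (join (pre_dmatch (nameless ev (push \<theta> em) p) (inc_v 0 (nameless ev em a)))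
        (pre_dmatch (nameless ev (push \<theta> em) q) (inc_v 0 (nameless ev em b))))"
      by (rule match_reading_join; rule App.IH; use App.prems u in simp)
    then show ?thesis
      using u by (auto simp: dmform_def mform_def)
  qed (auto simp: dmform_def mform_def)
next
  case (Lam \<theta>' p s)
  then show ?case
    by (cases u) (auto simp: dmform_def mform_def)
qed (simp add: dmform_def mform_def)

lemma match_reading_pmatch:
  assumes "index_env em" "distinct_binders u" "distinct \<theta>"
  shows "match_reading ev em \<theta> (pmatch \<theta> p u)
     (dmatch (length \<theta>) (nameless ev (push \<theta> em) p) (inc_v 0 (nameless ev em u)))"
proof -
  have "match_reading ev em \<theta> (check_dom (set \<theta>) \<mu>) (check_dom {1..length \<theta>} \<nu>)"
    if reading: "match_reading ev em \<theta> \<mu> \<nu>" for \<mu> \<nu>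
  proof (cases \<mu>)
    case (Subst \<tau>)
    with reading obtain \<sigma> where \<nu>: "\<nu> = Subst \<sigma>"
      by (cases \<nu>) auto
    \<comment> \<open>For distinct \<open>\<theta>\<close>, \<open>pos \<theta>\<close> maps
      \<open>set \<theta>\<close> bijectively onto \<open>{1..length \<theta>}\<close>, so both
      domain checks have the same outcome.\<close>
    have "fmdom' \<tau> = set \<theta> \<longleftrightarrow> fmdom' \<sigma> = {1..length \<theta>}"
      using reading inj_on_image_eq_iff[OF inj_on_pos, of "fmdom' \<tau>" \<theta> "set \<theta>"]
      by (simp add: Subst \<nu> pos_image[OF assms(3)])
    then show ?thesis
      using reading by (simp add: Subst \<nu>)
  qed (use reading in \<open>cases \<nu>; simp\<close>)+
  then show ?thesis
    using match_reading_pre_match[OF assms(1,2)] by (simp add: pmatch_def dmatch_def)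
qed

section \<open>Reading reductions\<close>

text \<open>A step is lifted to any preterm with distinct binders that has the given reading. The
  environments vary in the induction because steps below a binder are read in pushed ones.\<close>

lemma ppc_step_nameless:
  assumes inf: "infinite (UNIV :: 'a set)"
  shows "db_step d d' \<Longrightarrow> d = nameless ev em t \<Longrightarrow> distinct_binders t \<Longrightarrow>
    index_env ev \<Longrightarrow> index_env em \<Longrightarrow>
    \<exists>t' :: 'a preterm. distinct_binders t' \<and> nameless ev em t' = d' \<and>
      ppc_step (abs_ppc t) (abs_ppc t')"
proof (induction arbitrary: ev em t rule: db_step.induct)
  case (1 n p u s)
  then obtain \<theta> p' s' u' where t: "t = App (Lam \<theta> p' s') u'"
    by (cases t rule: preterm.exhaust; cases "case t of App a b \<Rightarrow> a") auto
  let ?\<mu> = "pmatch \<theta> p' u'" and ?\<nu> = "dmatch n p (inc_v 0 u)"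
  have eqs: "n = length \<theta>" "p = nameless ev (push \<theta> em) p'" "s = nameless (push \<theta> ev) em s'"
    "u = nameless ev em u'"
    using "1.prems"(1) t by simp_all
  have reading: "match_reading ev em \<theta> ?\<mu> ?\<nu>"
    unfolding eqs by (rule match_reading_pmatch) (use "1.prems" t in simp_all)
  have "distinct_binders (papply ?\<mu> s') \<and>
      nameless ev em (papply ?\<mu> s') = dec_v 0 (dapply ?\<nu> s)"
  proof (cases ?\<mu>)
    case (Subst \<tau>)
    with reading obtain \<sigma> where \<nu>: "?\<nu> = Subst \<sigma>"
      by (cases ?\<nu>) auto
    \<comment> \<open>The domain check succeeded, so a symbol without a value lies outside
      \<open>\<theta>\<close>, where \<open>push\<close> is \<open>shift 0\<close>, as
      \<open>nameless_psubst\<close> requires at \<open>k = 0\<close>.\<close>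
    have dom: "fmdom' \<tau> = set \<theta>"
      using Subst by (cases "pre_match \<theta> p' u'") (auto simp: pmatch_def split: if_splits)
    have "nameless ev em (psubst \<tau> s') =
        dec_v 0 (dsubst (0 + 1) \<sigma> (nameless (push \<theta> ev) em s'))"
    proof (rule nameless_psubst[OF inf])
      fix x w assume x: "fmlookup \<tau> x = Some w"
      then have "x \<in> set \<theta>"
        using dom fmdom'I by fastforce
      then show "fst (push \<theta> ev x) = 0 + 1 \<and>
          fmlookup \<sigma> (snd (push \<theta> ev x)) = Some (inc_v 0 (nameless ev em w))"
        using x reading by (simp add: Subst \<nu> push_def)
    next
      fix x assume "fmlookup \<tau> x = None"
      then have "x \<notin> set \<theta>"
        using dom by (metis fmdom'_notI)
      then show "push \<theta> ev x = shift 0 (ev x)"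
        using "1.prems" by (simp add: push_fresh)
    qed (use "1.prems" in simp_all)
    moreover have "distinct_binders (psubst \<tau> s')"
      by (rule distinct_binders_psubst[OF inf])
        (use reading "1.prems" t in \<open>auto simp: Subst \<nu>\<close>)
    ultimately show ?thesis
      using eqs(3) by (simp add: Subst \<nu>)
  next
    case Fail
    with reading have "?\<nu> = Fail"
      by (cases ?\<nu>) auto
    \<comment> \<open>\<open>Lam [a] (Mat a) (Var a)\<close> has the reading
      \<open>DLam 1 (DMat 1 1) (DVar 1 1)\<close> for every symbol \<open>a\<close>.
      \<open>dec_v 0\<close> fixes it, as the cutoff in the body is 1.\<close>
    with Fail show ?thesis
      by (simp add: push_def)
  next
    case Wait
    with reading have "?\<nu> = Wait"
      by (cases ?\<nu>) auto
    with "1.hyps" show ?thesis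
      by (simp add: decided_def)
  qed
  moreover have "decided ?\<mu>"
    using "1.hyps" reading by (cases ?\<mu>; cases ?\<nu>) (auto simp: decided_def)
  then have "ppc_step (abs_ppc t) (abs_ppc (papply ?\<mu> s'))"
    unfolding t by (rule ppc_step.intros)
  ultimately show ?case
    by blast
next
  case (2 d d' e)
  then obtain a b where t: "t = App a b"
    by (cases t) auto
  with 2 obtain a' where "distinct_binders a'" "nameless ev em a' = d'"
    "ppc_step (abs_ppc a) (abs_ppc a')"
    by force
  then show ?case
    using 2 by (intro exI[of _ "App a' b"])
      (simp add: t ppc_step.intros flip: PApp.abs_eq)
next
  case (3 e e' d)
  then obtain a b where t: "t = App a b"
    by (cases t) auto
  with 3 obtain b' where "distinct_binders b'" "nameless ev em b' = e'"
    "ppc_step (abs_ppc b) (abs_ppc b')"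
    by force
  then show ?case
    using 3 by (intro exI[of _ "App a b'"])
      (simp add: t ppc_step.intros flip: PApp.abs_eq)
next
  case (4 p p' n s)
  then obtain \<theta> a b where t: "t = Lam \<theta> a b"
    by (cases t) auto
  then obtain a' where "distinct_binders a'" "nameless ev (push \<theta> em) a' = p'"
    "ppc_step (abs_ppc a) (abs_ppc a')"
    using "4.IH"[of ev "push \<theta> em" a] "4.prems" by auto
  then show ?case
    using 4 by (intro exI[of _ "Lam \<theta> a' b"])
      (simp add: t ppc_step.intros flip: PLam.abs_eq)
next
  case (5 s s' n p)
  then obtain \<theta> a b where t: "t = Lam \<theta> a b"
    by (cases t) auto
  then obtain b' where "distinct_binders b'" "nameless (push \<theta> ev) em b' = s'"
    "ppc_step (abs_ppc b) (abs_ppc b')"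
    using "5.IH"[of "push \<theta> ev" em b] "5.prems" by auto
  then show ?case
    using 5 by (intro exI[of _ "Lam \<theta> a b'"])
      (simp add: t ppc_step.intros flip: PLam.abs_eq)
qed

section \<open>Free indices and bounds of readings\<close>

lemma lower_range_push:
  assumes "S \<subseteq> range (push \<theta> e)"
  shows "lower S \<subseteq> range e"
proof
  fix a assume "a \<in> lower S"
  then obtain i j where a: "a = (i - 1, j)" "(i, j) \<in> S" "i - 1 > 0"
    by (auto simp: lower_def)
  then obtain x where "(i, j) = push \<theta> e x"
    using assms by blast
  then have "a = e x"
    using a by (auto simp: push_def split: if_splits)
  then show "a \<in> range e"
    by blast
qed

text \<open>After the push, symbols outside \<open>\<theta>\<close> have primary index at least
  2.\<close>

lemma range_push_bound:
  assumes "index_env e" "(1, j) \<in> range (push \<theta> e)"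
  shows "j \<le> length \<theta>"
proof -
  obtain x where x: "push \<theta> e x = (1, j)"
    using assms(2) by (metis rangeE)
  then show ?thesis
    using index_env_ge_1[OF assms(1), of x] pos_le_length[of x \<theta>]
    by (auto simp: push_def split: if_splits)
qed

text \<open>Well-formedness of a reduct comes from here, since the reduct is itself a reading.
  Ranges of environments bound the free indices because secondary indices other than 1 may occur
  below binders.\<close>

lemma nameless_indices:
  "index_env ev \<Longrightarrow> index_env em \<Longrightarrow>
     fv (nameless ev em t) \<subseteq> range ev \<and> fm (nameless ev em t) \<subseteq> range em \<and>
     pos_indices (nameless ev em t) \<and> bounded (nameless ev em t)"
proof (induction t arbitrary: ev em)
  case (Lam \<theta> p s)
  let ?p = "nameless ev (push \<theta> em) p" and ?s = "nameless (push \<theta> ev) em s"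
  have p: "fv ?p \<subseteq> range ev" "fm ?p \<subseteq> range (push \<theta> em)" "pos_indices ?p" "bounded ?p"
    and s: "fv ?s \<subseteq> range (push \<theta> ev)" "fm ?s \<subseteq> range em" "pos_indices ?s" "bounded ?s"
    using Lam.IH(1)[of ev "push \<theta> em"] Lam.IH(2)[of "push \<theta> ev" em] Lam.prems by simp_all
  have "j \<le> length \<theta>" if "(1, j) \<in> fm ?p \<union> fv ?s" for j
    using that p(2) s(1) range_push_bound Lam.prems by blast
  then show ?case
    using p s lower_range_push[OF p(2)] lower_range_push[OF s(1)] by simp
qed (use index_env_ge_1 in \<open>force simp: prod_eq_iff\<close>)+

section \<open>Reading the backward translation\<close>

definition indices :: "'a list list \<Rightarrow> (nat \<times> nat) set" where
  "indices V = {(i, j). 1 \<le> i \<and> i \<le> length V \<and> 1 \<le> j \<and> j \<le> length (V ! (i - 1))}"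

text \<open>\<open>e\<close> inverts lookup in \<open>V\<close>, which forces the entries of
  \<open>V\<close> to be pairwise distinct.\<close>

definition env_of :: "'a list list \<Rightarrow> ('a \<Rightarrow> nat \<times> nat) \<Rightarrow> bool" where
  "env_of V e \<longleftrightarrow> (\<forall>(i, j) \<in> indices V. e (V ! (i - 1) ! (j - 1)) = (i, j))"

lemma indices_Cons: "(i, j) \<in> indices (\<theta> # V) \<longleftrightarrow>
    i = 1 \<and> 1 \<le> j \<and> j \<le> length \<theta> \<or> i \<ge> 2 \<and> (i - 1, j) \<in> indices V"
  by (cases "i - 1") (auto simp: indices_def nth_Cons split: nat.splits)

lemma indices_syms_of: "(i, j) \<in> indices V \<Longrightarrow> V ! (i - 1) ! (j - 1) \<in> syms_of V"
  unfolding indices_def syms_of_def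
  by (auto intro!: bexI[of _ "V ! (i - 1)"] nth_mem)

lemma env_of_push:
  assumes "env_of V e" "distinct \<theta>" "set \<theta> \<inter> syms_of V = {}"
  shows "env_of (\<theta> # V) (push \<theta> e)"
proof -
  have "push \<theta> e ((\<theta> # V) ! (i - 1) ! (j - 1)) = (i, j)" if ij: "(i, j) \<in> indices (\<theta> # V)" for i j
  proof (cases "i = 1")
    case True
    then show ?thesis
      using ij assms(2) by (auto simp: push_def indices_Cons pos_nth)
  next
    case False
    then have V: "(i - 1, j) \<in> indices V" "i \<ge> 2"
      using ij by (auto simp: indices_Cons)
    then have "V ! (i - 1 - 1) ! (j - 1) \<notin> set \<theta>"
      using indices_syms_of[OF V(1)] assms(3) by blast
    moreover have "(\<theta> # V) ! (i - 1) = V ! (i - 1 - 1)"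
      using V by (simp add: nth_Cons')
    moreover have "e (V ! (i - 1 - 1) ! (j - 1)) = (i - 1, j)"
      using assms(1) V unfolding env_of_def by blast
    ultimately show ?thesis
      using V by (simp add: push_def)
  qed
  then show ?thesis
    by (auto simp: env_of_def)
qed

lemma pos_indices_free: "pos_indices d \<Longrightarrow> (i, j) \<in> fv d \<union> fm d \<Longrightarrow> 1 \<le> i \<and> 1 \<le> j"
  by (induction d arbitrary: i j) (auto simp: lower_def)

text \<open>Pairs at level 1 fit into \<open>\<theta>\<close> by the bound at the binder; all others
  survive in \<open>lower S\<close>.\<close>

lemma subset_indices_Cons:
  assumes "lower S \<subseteq> indices V" "\<And>i j. (i, j) \<in> S \<Longrightarrow> 1 \<le> i \<and> 1 \<le> j"
    "\<And>j. (1, j) \<in> S \<Longrightarrow> j \<le> length \<theta>"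
  shows "S \<subseteq> indices (\<theta> # V)"
proof clarify
  fix i j assume ij: "(i, j) \<in> S"
  show "(i, j) \<in> indices (\<theta> # V)"
  proof (cases "i = 1")
    case True
    then show ?thesis
      using assms(2,3) ij by (auto simp: indices_Cons)
  next
    case False
    then have "i \<ge> 2"
      using assms(2)[OF ij] by simp
    moreover from this have "(i - 1, j) \<in> lower S"
      unfolding lower_def using ij by fastforce
    ultimately show ?thesis
      using assms(1) by (auto simp: indices_Cons)
  qed
qed

text \<open>The witness uses at each binder the very list that \<open>back_tr\<close> chooses. Its
  freshness and distinctness keep the environments inverse to lookup, by
  \<open>env_of_push\<close>.\<close>

lemma nameless_back_tr:
  assumes inf: "infinite (UNIV :: 'a set)"
  shows "pos_indices d \<Longrightarrow> bounded d \<Longrightarrow> fv d \<subseteq> indices V \<Longrightarrow> fm d \<subseteq> indices M \<Longrightarrow>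
    env_of V ev \<Longrightarrow> env_of M em \<Longrightarrow>
    \<exists>t :: 'a preterm. distinct_binders t \<and> nameless ev em t = d \<and> back_tr V M d = abs_ppc t"
proof (induction d arbitrary: V M ev em)
  case (DVar i j)
  then have "ev (V ! (i - 1) ! (j - 1)) = (i, j)"
    by (auto simp: env_of_def)
  then show ?case
    by (intro exI[of _ "Var (V ! (i - 1) ! (j - 1))"]) (simp add: PVar.abs_eq)
next
  case (DMat i j)
  then have "em (M ! (i - 1) ! (j - 1)) = (i, j)"
    by (auto simp: env_of_def)
  then show ?case
    by (intro exI[of _ "Mat (M ! (i - 1) ! (j - 1))"]) (simp add: PMat.abs_eq)
next
  case (DApp d e)
  obtain t where "distinct_binders t" "nameless ev em t = d" "back_tr V M d = abs_ppc t"
    using DApp.IH(1)[of V M ev em] DApp.prems by auto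
  moreover obtain u where "distinct_binders u" "nameless ev em u = e" "back_tr V M e = abs_ppc u"
    using DApp.IH(2)[of V M ev em] DApp.prems by auto
  ultimately show ?case
    by (intro exI[of _ "App t u"]) (simp add: PApp.abs_eq)
next
  case (DLam n p s)
  define \<theta> where
    "\<theta> = (SOME \<theta>. length \<theta> = n \<and> distinct \<theta> \<and> set \<theta> \<inter> (syms_of V \<union> syms_of M) = {})"
  have "finite (syms_of V \<union> syms_of M)"
    by (simp add: syms_of_def)
  from ex_fresh_list[OF inf this, of n]
  have "length \<theta> = n \<and> distinct \<theta> \<and> set \<theta> \<inter> (syms_of V \<union> syms_of M) = {}"
    unfolding \<theta>_def by (rule someI_ex)
  then have \<theta>: "length \<theta> = n" "distinct \<theta>" "set \<theta> \<inter> syms_of V = {}" "set \<theta> \<inter> syms_of M = {}"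
    by auto
  have "fm p \<subseteq> indices (\<theta> # M)"
    by (rule subset_indices_Cons) (use DLam.prems \<theta> pos_indices_free[of p] in auto)
  then obtain P where P: "distinct_binders P" "nameless ev (push \<theta> em) P = p"
    "back_tr V (\<theta> # M) p = abs_ppc P"
    using DLam.IH(1)[of V "\<theta> # M" ev "push \<theta> em"] env_of_push[of M em \<theta>] DLam.prems \<theta> by auto
  have "fv s \<subseteq> indices (\<theta> # V)"
    by (rule subset_indices_Cons) (use DLam.prems \<theta> pos_indices_free[of s] in auto)
  then obtain S where S: "distinct_binders S" "nameless (push \<theta> ev) em S = s"
    "back_tr (\<theta> # V) M s = abs_ppc S"
    using DLam.IH(2)[of "\<theta> # V" M "push \<theta> ev" em] env_of_push[of V ev \<theta>] DLam.prems \<theta> by auto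
  have "back_tr V M (DLam n p s) = PLam \<theta> (back_tr V (\<theta> # M) p) (back_tr (\<theta> # V) M s)"
    by (simp add: Let_def \<theta>_def)
  then show ?case
    using P S \<theta> by (intro exI[of _ "Lam \<theta> P S"]) (simp add: PLam.abs_eq)
qed

lemma finite_fv [simp]: "finite (fv d)" and finite_fm [simp]: "finite (fm d)"
proof -
  have lower: "finite (lower S)" if "finite S" for S
  proof (rule finite_subset)
    show "lower S \<subseteq> (\<lambda>(i, j). (i - 1, j)) ` S"
      by (force simp: lower_def)
  qed (use that in simp)
  show "finite (fv d)" "finite (fm d)"
    by (induction d) (simp_all add: lower)
qed

lemma ex_index_bound:
  assumes "well_formed d"
  shows "\<exists>n. fv d \<union> fm d \<subseteq> {1..n} \<times> {1}"
proof -
  \<comment> \<open>Without free indices \<open>Max\<close> is applied to the empty set; its value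
    is then immaterial, as the inclusion is vacuous.\<close>
  have "fv d \<union> fm d \<subseteq> {1..Max (fst ` (fv d \<union> fm d))} \<times> {1}"
  proof (rule subrelI)
    fix i j assume ij: "(i, j) \<in> fv d \<union> fm d"
    then have "j = 1" "1 \<le> i"
      using assms pos_indices_free[of d i j] by (auto simp: well_formed_def)
    moreover have "i \<le> Max (fst ` (fv d \<union> fm d))"
      using ij by (intro Max_ge) force+
    ultimately show "(i, j) \<in> {1..Max (fst ` (fv d \<union> fm d))} \<times> {1}"
      by simp
  qed
  then show ?thesis ..
qed

section \<open>Readings with respect to the enumeration of symbols\<close>

context
  fixes x :: "nat \<Rightarrow> 'a"
  assumes enumeration: "bij_betw x {1..} UNIV"
begin

text \<open>The secondary index is 1 because \<open>backward\<close> starts from singleton lists.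
  The assignment is independent of the number of lists, so both ends of a step are read in one
  environment even if \<open>backward\<close> chooses different numbers for them.\<close>

definition sym_index :: "'a \<Rightarrow> nat \<times> nat" where
  "sym_index a = (inv_into {1..} x a, 1)"

lemma infinite_syms: "infinite (UNIV :: 'a set)"
  using bij_betw_finite[OF enumeration] infinite_Ici[of "1 :: nat"] by simp

lemma index_env_sym_index: "index_env sym_index"
proof -
  have bij: "bij_betw (inv_into {1..} x) UNIV {1..}"
    using bij_betw_inv_into[OF enumeration] .
  then have "inj (inv_into {1..} x)"
    by (rule bij_betw_imp_inj_on)
  moreover have "1 \<le> inv_into {1..} x a" for a
    using bij_betwE[OF bij] by auto
  ultimately show ?thesis
    by (simp add: index_env_def sym_index_def inj_def)
qed

lemma nameless_backward:
  assumes "well_formed d"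
  shows "\<exists>t. distinct_binders t \<and> nameless sym_index sym_index t = d \<and>
    backward x d = abs_ppc t"
proof -
  define n where "n = (SOME n. fv d \<union> fm d \<subseteq> {1..n} \<times> {1})"
  define X where "X = map (\<lambda>i. [x i]) [1..<n + 1]"
  have n: "fv d \<union> fm d \<subseteq> {1..n} \<times> {1}"
    unfolding n_def using ex_index_bound[OF assms] by (rule someI_ex)
  have X_nth: "X ! (i - 1) = [x i]" if "1 \<le> i" "i \<le> n" for i
    using that nth_upt[of 1 "i - 1" "n + 1"] by (simp add: X_def del: upt_Suc)
  have indices: "indices X = {1..n} \<times> {1}"
    using X_nth by (auto simp: indices_def X_def simp del: upt_Suc)
  have "env_of X sym_index"
    unfolding env_of_def indices
    using X_nth bij_betw_inv_into_left[OF enumeration] by (auto simp: sym_index_def)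
  then have "\<exists>t. distinct_binders t \<and> nameless sym_index sym_index t = d \<and>
      back_tr X X d = abs_ppc t"
    using assms n by (intro nameless_back_tr[OF infinite_syms]) (auto simp: indices well_formed_def)
  moreover have "backward x d = back_tr X X d"
    unfolding backward_def n_def X_def by (simp only: Let_def)
  ultimately show ?thesis
    by simp
qed

lemma well_formed_nameless: "well_formed (nameless sym_index sym_index t)"
proof -
  have "range sym_index \<subseteq> UNIV \<times> {1}"
    by (auto simp: sym_index_def)
  then have "fv (nameless sym_index sym_index t) \<union> fm (nameless sym_index sym_index t) \<subseteq> UNIV \<times> {1}"
    using nameless_indices[OF index_env_sym_index index_env_sym_index, of t] by blast
  then show ?thesis
    using nameless_indices[OF index_env_sym_index index_env_sym_index, of t]
    by (auto simp: well_formed_def)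
qed

lemma ppc_step_backward:
  assumes "well_formed d" "db_step d d'"
  shows "ppc_step (backward x d) (backward x d')"
proof -
  obtain t where t: "distinct_binders t" "nameless sym_index sym_index t = d"
    "backward x d = abs_ppc t"
    using nameless_backward[OF assms(1)] by blast
  obtain t' where t': "distinct_binders t'" "nameless sym_index sym_index t' = d'"
    "ppc_step (abs_ppc t) (abs_ppc t')"
    using ppc_step_nameless[OF infinite_syms assms(2) t(2)[symmetric] t(1)]
      index_env_sym_index by blast
  \<comment> \<open>\<open>d'\<close> is well-formed as the reading of \<open>t'\<close>. The
    preterms \<open>t'\<close> and \<open>u\<close> may differ, but both have the reading
    \<open>d'\<close> and are therefore alpha-convertible.\<close>
  obtain u where u: "distinct_binders u" "nameless sym_index sym_index u = d'"
    "backward x d' = abs_ppc u"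
    using nameless_backward well_formed_nameless t'(2) by blast
  have "alpha t' u"
    using alpha_if_nameless_eq[OF infinite_syms] t' u index_env_sym_index by metis
  then have "abs_ppc t' = abs_ppc u"
    by (simp add: ppc.abs_eq_iff)
  then show ?thesis
    using t t' u by simp
qed

end

theorem theorem5p5:
  fixes x :: "nat \<Rightarrow> 'a" and t t' :: db
  assumes enumeration: "bij_betw x {1..} UNIV"
    and "well_formed t"
    and "db_step t t'"
  shows "ppc_step (backward x t) (backward x t')"
  using assms by (rule ppc_step_backward)

end
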